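(* Let $\mathscr{H}$ be a complex Hilbert space and, for each $n\in\mathbb{N}$, let $P_n\in\mathbb{B}(\mathscr{H})$ be the orthogonal projection onto a closed subspace $\mathscr{M}_n\subseteq\mathscr{H}$. Let $\sigma:\mathbb{N}\to\mathbb{N}$ be an infinite-periodic function such that $\Gamma_\infty=\emptyset$. Set $T_1:=P_{\sigma(1)}$ and $T_n:=P_{\sigma(n)}T_{n-1}$ for all $n\ge 2$. Then, for every $x\in\mathscr{H}$, the sequence $\{T_nx\}_{n=1}^\infty$ converges weakly to $Px$, where $P$ is the orthogonal projection onto $\bigcap_{i\in\mathbb{N}}\mathcal{R}(P_i)$.
   Context: Here $\mathbb{N}=\{1,2,3,\ldots\}$, $\mathbb{B}(\mathscr{H})$ is the algebra of bounded linear operators on $\mathscr{H}$, and $\mathcal{R}(T)$ is the range of $T$. Let $\sigma:\mathbb{N}\to\mathbb{N}$ be a surjective function such that $\sigma^{-1}(j)$ is infinite for every $j\in\mathbb{N}$. For each $j$, let $l_1<l_2<\cdots$ be the strictly increasing enumeration of $\sigma^{-1}(j)$, put $l_0=0$, and let $I(\sigma,j)=\sup_{n\ge1}(l_n-l_{n-1})\in[1,\infty]$. Let $\Gamma_F=\{j\in\mathbb{N}: I(\sigma,j)<\infty\}$ and $\Gamma_\infty=\mathbb{N}\setminus\Gamma_F$. Such a $\sigma$ is called infinite-periodic if $\Gamma_\infty$ is a finite set (possibly empty). *)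

theory Defs
  imports
    "HOL-Analysis.Analysis"
    "HOL-Library.Infinite_Set"
    "HOL-Library.Extended_Nat"
begin

text \<open>
  The norm, the metric and the topology are those of \<^class>\<open>real_inner\<close>, for the real inner
  product \<open>Re \<langle>x, y\<rangle>\<close> underlying the complex one; hence \<open>norm x = sqrt (Re \<langle>x, x\<rangle>)\<close>, and
  positive definiteness is inherited. The inner product is linear in its first argument.
\<close>

class complex_inner = real_inner +
  fixes scaleC :: "complex \<Rightarrow> 'a \<Rightarrow> 'a" (infixr "*\<^sub>C" 75)
    and cinner :: "'a \<Rightarrow> 'a \<Rightarrow> complex"
  assumes scaleC_add_right: "a *\<^sub>C (x + y) = a *\<^sub>C x + a *\<^sub>C y"
    and scaleC_add_left: "(a + b) *\<^sub>C x = a *\<^sub>C x + b *\<^sub>C x"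
    and scaleC_scaleC: "a *\<^sub>C (b *\<^sub>C x) = (a * b) *\<^sub>C x"
    and scaleC_of_real: "complex_of_real r *\<^sub>C x = r *\<^sub>R x"
    and cinner_commute: "cinner x y = cnj (cinner y x)"
    and cinner_add_left: "cinner (x + y) z = cinner x z + cinner y z"
    and cinner_scaleC_left: "cinner (a *\<^sub>C x) y = a * cinner x y"
    and inner_eq_Re_cinner: "inner x y = Re (cinner x y)"

class chilbert_space = complex_inner + complete_space

instantiation complex :: chilbert_space
begin

definition scaleC_complex :: "complex \<Rightarrow> complex \<Rightarrow> complex"
  where "scaleC_complex a x = a * x"

definition cinner_complex :: "complex \<Rightarrow> complex \<Rightarrow> complex"
  where "cinner_complex x y = x * cnj y"

instance
  by standard
    (auto simp: scaleC_complex_def cinner_complex_def algebra_simps scaleR_conv_of_real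
      inner_complex_def)

end

lemma scaleC_one: "1 *\<^sub>C x = (x :: 'a::complex_inner)"
  using scaleC_of_real[of 1 x] by simp

global_interpretation complex_vector: vector_space "scaleC :: complex \<Rightarrow> 'a \<Rightarrow> 'a::complex_inner"
  by standard (simp_all add: scaleC_add_right scaleC_add_left scaleC_scaleC scaleC_one)

abbreviation csubspace :: "'a::complex_inner set \<Rightarrow> bool"
  where "csubspace \<equiv> complex_vector.subspace"

definition bounded_clinear :: "('a::complex_inner \<Rightarrow> 'b::complex_inner) \<Rightarrow> bool"
  where "bounded_clinear f \<longleftrightarrow> Vector_Spaces.linear scaleC scaleC f \<and> bounded_linear f"

text \<open>
  The orthogonal projection onto \<open>M\<close>; the description denotes when \<open>M\<close> is a closed subspace of a
  Hilbert space, see \<open>orth_proj_unique_existence\<close> below.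
\<close>

definition orth_proj :: "'a::complex_inner set \<Rightarrow> 'a \<Rightarrow> 'a"
  where "orth_proj M x = (THE p. p \<in> M \<and> (\<forall>y\<in>M. cinner (x - p) y = 0))"

definition weakly_converges :: "(nat \<Rightarrow> 'a::complex_inner) \<Rightarrow> 'a \<Rightarrow> bool"
  where "weakly_converges f l \<longleftrightarrow> (\<forall>y. (\<lambda>n. cinner (f n) y) \<longlonglongrightarrow> cinner l y)"

lemma cinner_minus_left: "cinner (- x) z = - cinner (x :: 'a::complex_inner) z"
  using cinner_scaleC_left[of "-1" x z] scaleC_of_real[of "-1" x] by simp

lemma cinner_diff_left: "cinner (x - y) z = cinner x z - cinner (y :: 'a::complex_inner) z"
  using cinner_add_left[of x "- y" z] by (simp add: cinner_minus_left)

lemma cinner_scaleC_right: "cinner x (a *\<^sub>C y) = cnj a * cinner (x :: 'a::complex_inner) y"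
  by (metis cinner_commute cinner_scaleC_left complex_cnj_cnj complex_cnj_mult)

lemma cinner_eq_zeroI:
  fixes z :: "'a::complex_inner"
  assumes "csubspace M" and "\<And>y. y \<in> M \<Longrightarrow> inner z y = 0" and "y \<in> M"
  shows "cinner z y = 0"
proof -
  have "\<i> *\<^sub>C y \<in> M"
    using assms(1,3) by (rule complex_vector.subspace_scale)
  then have "Re (cinner z (\<i> *\<^sub>C y)) = 0"
    using assms(2) inner_eq_Re_cinner by metis
  moreover have "Re (cinner z y) = 0"
    using assms(2,3) inner_eq_Re_cinner by metis
  ultimately show ?thesis
    by (simp add: cinner_scaleC_right complex_eq_iff)
qed

lemma csubspace_scaleR: "csubspace M \<Longrightarrow> x \<in> M \<Longrightarrow> r *\<^sub>R x \<in> M"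
  by (metis complex_vector.subspace_scale scaleC_of_real)

lemma closest_point_exists:
  fixes M :: "'a::chilbert_space set"
  assumes M: "csubspace M" and cl: "closed M"
  obtains p where "p \<in> M" and "\<And>y. y \<in> M \<Longrightarrow> (norm (x - p))\<^sup>2 \<le> (norm (x - y))\<^sup>2"
proof -
  define D where "D = (INF y\<in>M. (norm (x - y))\<^sup>2)"
  have ne: "M \<noteq> {}"
    using complex_vector.subspace_0[OF M] by auto
  have bdd: "bdd_below ((\<lambda>y. (norm (x - y))\<^sup>2) ` M)"
    by (rule bdd_belowI[of _ 0]) auto
  have D: "D \<le> (norm (x - y))\<^sup>2" if "y \<in> M" for y
    unfolding D_def using bdd that by (rule cINF_lower)
  have "\<exists>y\<in>M. (norm (x - y))\<^sup>2 < D + inverse (real (Suc n))" for n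
  proof -
    have "D < D + inverse (real (Suc n))" by simp
    then show ?thesis
      unfolding D_def using cINF_less_iff[OF ne bdd] by blast
  qed
  then obtain q where q: "\<And>n. q n \<in> M"
    and q_less: "\<And>n. (norm (x - q n))\<^sup>2 < D + inverse (real (Suc n))"
    by metis
  have gap: "(norm (q m - q n))\<^sup>2 \<le> 4 * inverse (real (Suc N))" if "m \<ge> N" "n \<ge> N" for m n N
  proof -
    have mid: "(1/2) *\<^sub>R (q m + q n) \<in> M"
      by (intro csubspace_scaleR M complex_vector.subspace_add q)
    have "(norm (q m - q n))\<^sup>2 + 4 * (norm (x - (1/2) *\<^sub>R (q m + q n)))\<^sup>2
        = 2 * (norm (x - q m))\<^sup>2 + 2 * (norm (x - q n))\<^sup>2"
      by (simp add: power2_norm_eq_inner inner_diff_left inner_diff_right inner_add_left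
          inner_add_right inner_commute algebra_simps)
    moreover have "inverse (real (Suc m)) \<le> inverse (real (Suc N))"
      "inverse (real (Suc n)) \<le> inverse (real (Suc N))"
      using that by (auto intro!: le_imp_inverse_le)
    ultimately show ?thesis
      using D[OF mid] q_less[of m] q_less[of n] by linarith
  qed
  have "Cauchy q"
  proof (rule metric_CauchyI)
    fix e :: real
    assume e: "0 < e"
    then obtain N where N: "inverse (real (Suc N)) < e\<^sup>2 / 4"
      using reals_Archimedean[of "e\<^sup>2 / 4"] by auto
    have "dist (q m) (q n) < e" if "m \<ge> N" "n \<ge> N" for m n
    proof -
      have "(norm (q m - q n))\<^sup>2 < e\<^sup>2"
        using gap[OF that] N by linarith
      then show ?thesis
        using e by (simp add: dist_norm power2_less_imp_less)
    qed
    then show "\<exists>N. \<forall>m\<ge>N. \<forall>n\<ge>N. dist (q m) (q n) < e" by blast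
  qed
  then obtain p where p: "q \<longlonglongrightarrow> p"
    using Cauchy_convergent convergent_def by blast
  have "p \<in> M"
    using cl q p closed_sequentially by blast
  moreover have "(norm (x - p))\<^sup>2 \<le> D"
  proof (rule LIMSEQ_le)
    show "(\<lambda>n. (norm (x - q n))\<^sup>2) \<longlonglongrightarrow> (norm (x - p))\<^sup>2"
      by (intro tendsto_intros p)
    show "(\<lambda>n. D + inverse (real (Suc n))) \<longlonglongrightarrow> D"
      using tendsto_add[OF tendsto_const LIMSEQ_inverse_real_of_nat, of D] by simp
    show "\<exists>N. \<forall>n\<ge>N. (norm (x - q n))\<^sup>2 \<le> D + inverse (real (Suc n))"
      using q_less less_imp_le by blast
  qed
  ultimately show thesis
    using that D order_trans by blast
qed

lemma orth_proj_unique_existence: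
  fixes M :: "'a::chilbert_space set"
  assumes M: "csubspace M" and cl: "closed M"
  shows "\<exists>!p. p \<in> M \<and> (\<forall>y\<in>M. cinner (x - p) y = 0)"
proof (rule ex_ex1I)
  obtain p where p: "p \<in> M" and min: "\<And>y. y \<in> M \<Longrightarrow> (norm (x - p))\<^sup>2 \<le> (norm (x - y))\<^sup>2"
    using closest_point_exists[OF assms] by metis
  have "inner (x - p) y = 0" if y: "y \<in> M" for y
  proof (cases "y = 0")
    case False
    define a where "a = inner (x - p) y"
    define t where "t = a / inner y y"
    have pos: "inner y y > 0"
      using False by simp
    have "p + t *\<^sub>R y \<in> M"
      by (intro complex_vector.subspace_add M p csubspace_scaleR y)
    then have "(norm (x - p))\<^sup>2 \<le> (norm ((x - p) - t *\<^sub>R y))\<^sup>2"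
      using min[of "p + t *\<^sub>R y"] by (simp add: algebra_simps)
    also have "\<dots> = (norm (x - p))\<^sup>2 - 2 * t * a + t * t * inner y y"
      unfolding power2_norm_eq_inner a_def
      by (simp only: inner_diff_left[of _ "t *\<^sub>R y"] inner_diff_right[of _ _ "t *\<^sub>R y"])
        (simp add: inner_commute algebra_simps)
    also have "\<dots> = (norm (x - p))\<^sup>2 - a\<^sup>2 / inner y y"
      using pos by (simp add: t_def field_simps power2_eq_square)
    finally have "a\<^sup>2 / inner y y \<le> 0" by simp
    then have "a = 0"
      using pos by (simp add: divide_le_0_iff)
    then show ?thesis by (simp add: a_def)
  qed simp
  then show "\<exists>p. p \<in> M \<and> (\<forall>y\<in>M. cinner (x - p) y = 0)"
    using p cinner_eq_zeroI[OF M] by blast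
next
  fix p q
  assume p: "p \<in> M \<and> (\<forall>y\<in>M. cinner (x - p) y = 0)"
    and q: "q \<in> M \<and> (\<forall>y\<in>M. cinner (x - q) y = 0)"
  have "p - q \<in> M"
    using p q by (simp add: complex_vector.subspace_diff M)
  then have "cinner (x - q) (p - q) - cinner (x - p) (p - q) = 0"
    using p q by simp
  then have "cinner (p - q) (p - q) = 0"
    by (simp add: cinner_diff_left)
  then have "inner (p - q) (p - q) = 0"
    by (simp add: inner_eq_Re_cinner)
  then show "p = q" by simp
qed

lemma orth_proj:
  fixes M :: "'a::chilbert_space set"
  assumes "csubspace M" and "closed M"
  shows orth_proj_in: "orth_proj M x \<in> M"
    and orth_proj_orthogonal: "y \<in> M \<Longrightarrow> cinner (x - orth_proj M x) y = 0"
  using theI'[OF orth_proj_unique_existence[OF assms, of x]] by (auto simp: orth_proj_def)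

lemma orth_proj_eqI:
  fixes M :: "'a::chilbert_space set"
  assumes "csubspace M" and "closed M" and "p \<in> M" and "\<And>y. y \<in> M \<Longrightarrow> cinner (x - p) y = 0"
  shows "orth_proj M x = p"
  unfolding orth_proj_def
  using assms by (intro the1_equality orth_proj_unique_existence) auto

lemma range_orth_proj:
  fixes M :: "'a::chilbert_space set"
  assumes "csubspace M" and "closed M"
  shows "range (orth_proj M) = M"
proof -
  have "orth_proj M y = y" if "y \<in> M" for y
    using that cinner_diff_left[of y y] by (intro orth_proj_eqI assms) auto
  then show ?thesis
    using orth_proj_in[OF assms] by (metis image_subset_iff rangeI subsetI subset_antisym)
qed

lemma bounded_clinear_orth_proj:
  fixes M :: "'a::chilbert_space set"
  assumes M: "csubspace M" and cl: "closed M"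
  shows "bounded_clinear (orth_proj M)"
proof -
  let ?P = "orth_proj M"
  have add: "?P (x + y) = ?P x + ?P y" for x y
  proof (rule orth_proj_eqI[OF assms])
    show "?P x + ?P y \<in> M"
      by (intro complex_vector.subspace_add M orth_proj_in cl)
    fix z assume "z \<in> M"
    then show "cinner (x + y - (?P x + ?P y)) z = 0"
      using orth_proj_orthogonal[OF assms, of z x] orth_proj_orthogonal[OF assms, of z y]
      by (simp add: cinner_diff_left cinner_add_left)
  qed
  have scale: "?P (c *\<^sub>C x) = c *\<^sub>C ?P x" for c x
  proof (rule orth_proj_eqI[OF assms])
    show "c *\<^sub>C ?P x \<in> M"
      by (intro complex_vector.subspace_scale M orth_proj_in cl)
    fix z assume "z \<in> M"
    then show "cinner (c *\<^sub>C x - c *\<^sub>C ?P x) z = 0"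
      using orth_proj_orthogonal[OF assms, of z x]
      by (simp add: cinner_diff_left cinner_scaleC_left)
  qed
  have bound: "norm (?P x) \<le> norm x" for x
  proof -
    have "inner (x - ?P x) (?P x) = 0"
      using orth_proj_orthogonal[OF assms orth_proj_in[OF assms]] by (simp add: inner_eq_Re_cinner)
    then have "norm (?P x) * norm (?P x) \<le> norm x * norm (?P x)"
      using norm_cauchy_schwarz[of x "?P x"]
      by (simp add: inner_diff_left flip: power2_eq_square power2_norm_eq_inner)
    then show ?thesis
      by (cases "?P x = 0") auto
  qed
  have "bounded_linear ?P"
  proof (rule bounded_linear_intro[where K = 1])
    show "?P (r *\<^sub>R x) = r *\<^sub>R ?P x" for r x
      using scale[of "complex_of_real r" x] by (simp add: scaleC_of_real)
  qed (use add bound in auto)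
  moreover have "Vector_Spaces.linear scaleC scaleC ?P"
    by unfold_locales (use add scale in auto)
  ultimately show ?thesis
    by (simp add: bounded_clinear_def)
qed

text \<open>
  Here the natural numbers of the source start at \<open>1\<close>: a function from the positive integers to
  the positive integers is a \<open>nat \<Rightarrow> nat\<close> of which only the restriction to \<open>{1..}\<close> matters.
\<close>

definition fiber :: "(nat \<Rightarrow> nat) \<Rightarrow> nat \<Rightarrow> nat set"
  where "fiber \<sigma> j = {n \<in> {1..}. \<sigma> n = j}"

text \<open>
  \<open>fiber_enum \<sigma> j n\<close> is \<open>l\<^sub>n\<close>. The library function \<^const>\<open>enumerate\<close> is the strictly
  increasing enumeration of an infinite set, counted from \<open>0\<close>.
\<close>

definition fiber_enum :: "(nat \<Rightarrow> nat) \<Rightarrow> nat \<Rightarrow> nat \<Rightarrow> nat"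
  where "fiber_enum \<sigma> j n = (if n = 0 then 0 else enumerate (fiber \<sigma> j) (n - 1))"

text \<open>The truncated subtraction is harmless, as \<open>l\<^sub>0 < l\<^sub>1 < \<dots>\<close>.\<close>

definition max_gap :: "(nat \<Rightarrow> nat) \<Rightarrow> nat \<Rightarrow> enat"
  where "max_gap \<sigma> j = (SUP n\<in>{1..}. enat (fiber_enum \<sigma> j n - fiber_enum \<sigma> j (n - 1)))"

definition Gamma_F :: "(nat \<Rightarrow> nat) \<Rightarrow> nat set"
  where "Gamma_F \<sigma> = {j \<in> {1..}. max_gap \<sigma> j < \<infinity>}"

definition Gamma_inf :: "(nat \<Rightarrow> nat) \<Rightarrow> nat set"
  where "Gamma_inf \<sigma> = {1..} - Gamma_F \<sigma>"

definition infinite_periodic :: "(nat \<Rightarrow> nat) \<Rightarrow> bool"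
  where "infinite_periodic \<sigma> \<longleftrightarrow>
    \<sigma> ` {1..} = {1..} \<and> (\<forall>j\<in>{1..}. infinite (fiber \<sigma> j)) \<and> finite (Gamma_inf \<sigma>)"

end

theory Submission
  imports Defs
begin

text \<open>
  By Pythagoras the increments of \<open>T\<^sub>n x\<close> tend to \<open>0\<close>. Every window of \<open>I(\<sigma>, j)\<close>
  consecutive indices contains one at which the orbit lies in \<open>\<M>\<^sub>j\<close>, so the distance from
  \<open>T\<^sub>n x\<close> to \<open>\<M>\<^sub>j\<close> tends to \<open>0\<close> and \<open>T\<^sub>n x\<close> tends to \<open>0\<close> weakly against
  \<open>\<M>\<^sub>j\<^sup>\<bottom>\<close>. Against a vector of \<open>\<Inter>\<^sub>j \<M>\<^sub>j\<close> the inner product with \<open>T\<^sub>n x\<close> is constant. Since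
  the sequence is bounded, the vectors against which \<open>T\<^sub>n x - P x\<close> tends to \<open>0\<close> form a
  closed subspace, and one that contains \<open>\<Inter>\<^sub>j \<M>\<^sub>j\<close> and all \<open>\<M>\<^sub>j\<^sup>\<bottom>\<close> is the whole space.
\<close>

section \<open>Complex inner products and the Cauchy-Schwarz inequality\<close>

lemma cinner_diff_right: "cinner x (y - z) = cinner x y - cinner (x :: 'a::complex_inner) z"
  by (metis cinner_commute cinner_diff_left complex_cnj_diff)

lemma cinner_add_right: "cinner x (y + z) = cinner x y + cinner (x :: 'a::complex_inner) z"
  by (metis cinner_commute cinner_add_left complex_cnj_add)

lemma cinner_zero_left [simp]: "cinner 0 (x :: 'a::complex_inner) = 0"
  using cinner_diff_left[of 0 0 x] by simp

lemma cinner_zero_right [simp]: "cinner (x :: 'a::complex_inner) 0 = 0"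
  using cinner_diff_right[of x 0 0] by simp

lemma cinner_eq_zero_sym: "cinner x y = 0 \<Longrightarrow> cinner y (x :: 'a::complex_inner) = 0"
  by (metis cinner_commute complex_cnj_zero)

lemma cinner_self_eq_zero: "cinner x x = 0 \<Longrightarrow> x = (0 :: 'a::complex_inner)"
  by (metis inner_eq_Re_cinner inner_eq_zero_iff zero_complex.sel(1))

lemma norm_scaleC: "norm (a *\<^sub>C x) = cmod a * norm (x :: 'a::complex_inner)"
proof -
  have "(norm (a *\<^sub>C x))\<^sup>2 = Re ((a * cnj a) * cinner x x)"
    by (simp add: power2_norm_eq_inner inner_eq_Re_cinner cinner_scaleC_left cinner_scaleC_right
        algebra_simps)
  also have "\<dots> = (cmod a * norm x)\<^sup>2"
    by (simp add: power2_norm_eq_inner inner_eq_Re_cinner power_mult_distrib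
        flip: complex_norm_square)
  finally show ?thesis
    by (simp add: power2_eq_iff_nonneg)
qed

lemma cinner_cauchy_schwarz: "cmod (cinner x y) \<le> norm x * norm (y :: 'a::complex_inner)"
proof (cases "cinner x y = 0")
  case False
  define c where "c = cinner x y"
  \<comment> \<open>Multiplying \<open>x\<close> by \<open>cnj c\<close> makes its inner product
    with \<open>y\<close> real and nonnegative, so the real Cauchy-Schwarz inequality applies; a
    factor \<open>cmod c\<close> then cancels.\<close>
  have "cmod c * cmod c = Re (cnj c * c)"
    by (simp flip: power2_eq_square add: cmod_power2)
  also have "\<dots> = inner (cnj c *\<^sub>C x) y"
    by (simp add: inner_eq_Re_cinner cinner_scaleC_left c_def)
  also have "\<dots> \<le> cmod c * (norm x * norm y)"
    using norm_cauchy_schwarz[of "cnj c *\<^sub>C x" y] by (simp add: norm_scaleC mult.assoc)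
  finally show ?thesis
    using False by (simp add: c_def)
qed simp

section \<open>Closed subspaces of test vectors\<close>

lemma csubspace_weak_null:
  "csubspace {y. (\<lambda>n. cinner (z n) y) \<longlonglongrightarrow> 0}" for z :: "nat \<Rightarrow> 'a::complex_inner"
  unfolding complex_vector.subspace_def
  by (auto simp: cinner_add_right cinner_scaleC_right
      intro: tendsto_add_zero tendsto_mult_right_zero)

text \<open>By Cauchy-Schwarz the norm bound makes the functionals given by the \<open>z n\<close>
  uniformly Lipschitz, so replacing a test vector by a nearby one costs an error independent of
  \<open>n\<close>.\<close>

lemma closed_weak_null:
  fixes z :: "nat \<Rightarrow> 'a::complex_inner"
  assumes bound: "\<And>n. norm (z n) \<le> B"
  shows "closed {y. (\<lambda>n. cinner (z n) y) \<longlonglongrightarrow> 0}" (is "closed ?W")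
proof (unfold closure_subset_eq[symmetric], rule subsetI)
  fix y assume "y \<in> closure ?W"
  then have y: "\<exists>w\<in>?W. dist w y < e" if "0 < e" for e
    using that by (simp only: closure_approachable)
  have B: "0 \<le> B"
    using bound norm_ge_zero order_trans by blast
  have "\<exists>N. \<forall>n\<ge>N. cmod (cinner (z n) y) < e" if e: "0 < e" for e
  proof -
    \<comment> \<open>The divisor uses \<open>B + 1\<close> so that \<open>B = 0\<close> is covered
      as well.\<close>
    obtain w where w: "w \<in> ?W" "dist w y < e / (2 * (B + 1))"
      using y[of "e / (2 * (B + 1))"] e B by auto
    obtain N where N: "\<And>n. n \<ge> N \<Longrightarrow> cmod (cinner (z n) w) < e / 2"
      using LIMSEQ_D[of "\<lambda>n. cinner (z n) w" 0 "e / 2"] w(1) e by auto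
    have "cmod (cinner (z n) y) < e" if "n \<ge> N" for n
    proof -
      have "cmod (cinner (z n) (y - w)) \<le> B * norm (y - w)"
        using cinner_cauchy_schwarz[of "z n" "y - w"] bound[of n]
        by (meson mult_right_mono norm_ge_zero order_trans)
      also have "\<dots> \<le> (B + 1) * norm (y - w)"
        by (simp add: mult_right_mono)
      also have "\<dots> < e / 2"
        using w(2) B by (simp add: dist_norm norm_minus_commute field_simps)
      finally have "cmod (cinner (z n) y - cinner (z n) w) < e / 2"
        by (simp add: cinner_diff_right)
      then show ?thesis
        using N[OF that] norm_triangle_sub[of "cinner (z n) y" "cinner (z n) w"] by linarith
    qed
    then show ?thesis by blast
  qed
  then show "y \<in> ?W"
    by (simp add: LIMSEQ_iff)
qed

text \<open>Let \<open>q\<close> be the part of a vector orthogonal to \<open>W\<close>. Its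
  component orthogonal to \<open>M i\<close> lies in \<open>W\<close>, so \<open>q\<close> is
  orthogonal to that component, which therefore vanishes. Hence \<open>q\<close> lies in every
  \<open>M i\<close>, thus in \<open>W\<close>, and is orthogonal to itself.\<close>

lemma closed_csubspace_eq_UNIV:
  fixes M :: "'i \<Rightarrow> 'a::chilbert_space set"
  assumes W: "csubspace W" "closed W"
    and M: "\<And>i. i \<in> I \<Longrightarrow> csubspace (M i) \<and> closed (M i)"
    and orth: "\<And>i y. i \<in> I \<Longrightarrow> (\<And>v. v \<in> M i \<Longrightarrow> cinner y v = 0) \<Longrightarrow> y \<in> W"
    and inter: "(\<Inter>i\<in>I. M i) \<subseteq> W"
  shows "W = UNIV"
proof -
  have "y \<in> W" for y
  proof -
    define q where "q = y - orth_proj W y"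
    have q: "cinner q w = 0" if "w \<in> W" for w
      using orth_proj_orthogonal[OF W that] by (simp add: q_def)
    have "q \<in> M i" if i: "i \<in> I" for i
    proof -
      let ?r = "q - orth_proj (M i) q"
      note Mi = M[OF i, THEN conjunct1] M[OF i, THEN conjunct2]
      have "?r \<in> W"
        using orth[OF i] orth_proj_orthogonal[OF Mi] by blast
      then have "cinner q ?r = 0"
        by (rule q)
      moreover have "cinner (orth_proj (M i) q) ?r = 0"
        by (rule cinner_eq_zero_sym) (intro orth_proj_orthogonal orth_proj_in Mi)
      ultimately have "cinner ?r ?r = 0"
        by (simp only: cinner_diff_left[of q] diff_self)
      then have "?r = 0"
        by (rule cinner_self_eq_zero)
      then show ?thesis
        using orth_proj_in[OF Mi, of q] by simp
    qed
    then have "q \<in> W"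
      using inter by blast
    then have "q = 0"
      using q cinner_self_eq_zero by blast
    then show ?thesis
      using orth_proj_in[OF W, of y] by (simp add: q_def)
  qed
  then show ?thesis by blast
qed

section \<open>Orbits under successive orthogonal projections\<close>

lemma norm_diff_orth_proj_add:
  fixes M :: "'a::chilbert_space set"
  assumes M: "csubspace M" "closed M" and y: "y \<in> M"
  shows "(norm (x - y))\<^sup>2 = (norm (x - orth_proj M x))\<^sup>2 + (norm (orth_proj M x - y))\<^sup>2"
proof -
  have "orth_proj M x - y \<in> M"
    by (intro complex_vector.subspace_diff orth_proj_in M y)
  then have "inner (x - orth_proj M x) (orth_proj M x - y) = 0"
    using orth_proj_orthogonal[OF M] by (simp add: inner_eq_Re_cinner)
  then show ?thesis
    using norm_add_Pythagorean[of "x - orth_proj M x" "orth_proj M x - y"]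
    by (simp add: orthogonal_def)
qed

lemma norm_diff_orth_proj_le:
  fixes M :: "'a::chilbert_space set"
  assumes "csubspace M" "closed M" "y \<in> M"
  shows "norm (x - orth_proj M x) \<le> norm (x - y)"
proof (rule power2_le_imp_le)
  show "(norm (x - orth_proj M x))\<^sup>2 \<le> (norm (x - y))\<^sup>2"
    unfolding norm_diff_orth_proj_add[OF assms, of x] by simp
qed simp

context
  fixes A :: "nat \<Rightarrow> 'a::chilbert_space set" and u :: "nat \<Rightarrow> 'a"
  assumes A: "\<And>n. csubspace (A n)" "\<And>n. closed (A n)"
    and step: "\<And>n. u (Suc n) = orth_proj (A n) (u n)"
begin

lemma orbit_norm_Suc: "(norm (u n))\<^sup>2 = (norm (u n - u (Suc n)))\<^sup>2 + (norm (u (Suc n)))\<^sup>2"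
  using norm_diff_orth_proj_add[OF A complex_vector.subspace_0[OF A(1)], of "u n" n]
  by (simp add: step)

lemma orbit_norm_decseq: "decseq (\<lambda>n. (norm (u n))\<^sup>2)"
proof (rule decseq_SucI)
  show "(norm (u (Suc n)))\<^sup>2 \<le> (norm (u n))\<^sup>2" for n
    using orbit_norm_Suc[of n] zero_le_power2[of "norm (u n - u (Suc n))"] by linarith
qed

lemma orbit_norm_le: "norm (u n) \<le> norm (u 0)"
  by (rule power2_le_imp_le[OF decseqD[OF orbit_norm_decseq]]) simp_all

text \<open>The squared norms decrease and are nonnegative, hence converge; by
  \<open>orbit_norm_Suc\<close> their consecutive differences are the squared increments.\<close>

lemma orbit_increments: "(\<lambda>n. norm (u n - u (Suc n))) \<longlonglongrightarrow> 0"
proof -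
  obtain L where L: "(\<lambda>n. (norm (u n))\<^sup>2) \<longlonglongrightarrow> L"
    using decseq_convergent[OF orbit_norm_decseq, of 0] by auto
  have "(\<lambda>n. (norm (u n))\<^sup>2 - (norm (u (Suc n)))\<^sup>2) \<longlonglongrightarrow> L - L"
    by (intro tendsto_diff L LIMSEQ_Suc)
  moreover have "(norm (u n))\<^sup>2 - (norm (u (Suc n)))\<^sup>2 = (norm (u n - u (Suc n)))\<^sup>2" for n
    using orbit_norm_Suc[of n] by linarith
  ultimately have "(\<lambda>n. (norm (u n - u (Suc n)))\<^sup>2) \<longlonglongrightarrow> 0"
    by simp
  then show ?thesis
    using tendsto_real_sqrt by fastforce
qed

lemma norm_orbit_diff_le: "norm (u n - u (n + k)) \<le> (\<Sum>i<k. norm (u (n + i) - u (Suc (n + i))))"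
proof (induction k)
  case (Suc k)
  then show ?case
    using norm_triangle_ineq[of "u n - u (n + k)" "u (n + k) - u (Suc (n + k))"] by simp
qed simp

lemma orbit_dist_null:
  assumes M: "csubspace M" "closed M"
    and visit: "\<And>n. \<exists>k\<le>K. u (n + k) \<in> M"
  shows "(\<lambda>n. u n - orth_proj M (u n)) \<longlonglongrightarrow> 0"
proof (rule Lim_null_comparison)
  have "norm (u n - orth_proj M (u n)) \<le> (\<Sum>i<K. norm (u (n + i) - u (Suc (n + i))))" for n
  proof -
    obtain k where k: "k \<le> K" "u (n + k) \<in> M"
      using visit by blast
    have "norm (u n - orth_proj M (u n)) \<le> norm (u n - u (n + k))"
      by (intro norm_diff_orth_proj_le M k)
    also have "\<dots> \<le> (\<Sum>i<k. norm (u (n + i) - u (Suc (n + i))))"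
      by (rule norm_orbit_diff_le)
    \<comment> \<open>The waiting time \<open>k\<close> depends on \<open>n\<close>. Padding with
      nonnegative terms gives a fixed number \<open>K\<close> of summands, each a null sequence in
      \<open>n\<close>.\<close>
    also have "\<dots> \<le> (\<Sum>i<K. norm (u (n + i) - u (Suc (n + i))))"
      using k(1) by (intro sum_mono2) auto
    finally show ?thesis .
  qed
  then show "\<forall>\<^sub>F n in sequentially.
      norm (u n - orth_proj M (u n)) \<le> (\<Sum>i<K. norm (u (n + i) - u (Suc (n + i))))"
    by simp
  show "(\<lambda>n. \<Sum>i<K. norm (u (n + i) - u (Suc (n + i)))) \<longlonglongrightarrow> 0"
    by (intro tendsto_null_sum LIMSEQ_ignore_initial_segment[OF orbit_increments])
qed

text \<open>Each increment \<open>u n - u (Suc n)\<close> is orthogonal to \<open>A n\<close>, hence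
  to \<open>y\<close>.\<close>

lemma cinner_orbit_eq:
  assumes "\<And>n. y \<in> A n"
  shows "cinner (u n) y = cinner (u 0) y"
proof (induction n)
  case (Suc n)
  then show ?case
    using orth_proj_orthogonal[OF A assms, of "u n" n] by (simp add: step cinner_diff_left)
qed simp

lemma orbit_weakly_converges:
  fixes M :: "'i \<Rightarrow> 'a set"
  assumes M: "\<And>i. i \<in> I \<Longrightarrow> csubspace (M i) \<and> closed (M i)"
    and A_in: "\<And>n. A n \<in> M ` I"
    and visit: "\<And>i. i \<in> I \<Longrightarrow> \<exists>K. \<forall>n. \<exists>k\<le>K. u (n + k) \<in> M i"
  shows "weakly_converges u (orth_proj (\<Inter>i\<in>I. M i) (u 0))"
proof -
  define N where "N = (\<Inter>i\<in>I. M i)"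
  define p where "p = orth_proj N (u 0)"
  define W where "W = {y. (\<lambda>n. cinner (u n - p) y) \<longlonglongrightarrow> 0}"
  have N: "csubspace N" "closed N"
    using M by (auto simp: N_def complex_vector.subspace_def intro!: closed_INT)
  have p: "p \<in> N"
    unfolding p_def by (rule orth_proj_in[OF N])
  have "norm (u n - p) \<le> norm (u 0) + norm p" for n
    using norm_triangle_ineq4[of "u n" p] orbit_norm_le[of n] by linarith
  then have W: "csubspace W" "closed W"
    unfolding W_def by (intro csubspace_weak_null closed_weak_null)+
  have "W = UNIV"
  proof (rule closed_csubspace_eq_UNIV[OF W M])
    fix i y assume i: "i \<in> I" and y: "\<And>v. v \<in> M i \<Longrightarrow> cinner y v = 0"
    note Mi = M[OF i, THEN conjunct1] M[OF i, THEN conjunct2]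
    have yM: "cinner v y = 0" if "v \<in> M i" for v
      using y[OF that] by (rule cinner_eq_zero_sym)
    \<comment> \<open>Both \<open>p\<close> and the projection of \<open>u n\<close> lie in
      \<open>M i\<close>, to which \<open>y\<close> is orthogonal, so one may replace the
      other.\<close>
    have eq: "cinner (u n - p) y = cinner (u n - orth_proj (M i) (u n)) y" for n
      using yM[of p] yM[OF orth_proj_in[OF Mi]] p i by (simp add: cinner_diff_left N_def)
    obtain K where "\<And>n. \<exists>k\<le>K. u (n + k) \<in> M i"
      using visit[OF i] by blast
    then have "(\<lambda>n. norm (u n - orth_proj (M i) (u n)) * norm y) \<longlonglongrightarrow> 0"
      by (intro tendsto_mult_left_zero tendsto_norm_zero orbit_dist_null Mi)
    then have "(\<lambda>n. cinner (u n - p) y) \<longlonglongrightarrow> 0"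
      unfolding eq
      by (rule Lim_null_comparison[rotated]) (simp add: cinner_cauchy_schwarz)
    then show "y \<in> W"
      by (simp add: W_def)
  next
    have "y \<in> W" if y: "y \<in> N" for y
    proof -
      have "y \<in> A n" for n
        using y A_in[of n] by (auto simp: N_def)
      then have "cinner (u n - p) y = cinner (u 0 - p) y" for n
        using cinner_orbit_eq[of y n] by (simp add: cinner_diff_left)
      also have "cinner (u 0 - p) y = 0"
        unfolding p_def by (rule orth_proj_orthogonal[OF N y])
      finally show ?thesis
        by (simp add: W_def)
    qed
    then show "(\<Inter>i\<in>I. M i) \<subseteq> W"
      by (auto simp: N_def)
  qed auto
  then have "(\<lambda>n. cinner (u n - p) y) \<longlonglongrightarrow> 0" for y
    by (auto simp: W_def)
  then have "(\<lambda>n. cinner (u n) y) \<longlonglongrightarrow> cinner p y" for y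
    by (subst LIM_zero_iff[symmetric]) (simp add: cinner_diff_left)
  then show ?thesis
    by (simp add: weakly_converges_def p_def N_def)
qed

end

section \<open>Bounded waiting times from bounded gaps\<close>

lemma bounded_gap_visit:
  assumes inf: "infinite (fiber \<sigma> j)" and fin: "max_gap \<sigma> j < \<infinity>"
  obtains K where "\<And>n. \<exists>k\<le>K. n + k \<in> fiber \<sigma> j"
proof -
  let ?l = "fiber_enum \<sigma> j"
  obtain K where K: "max_gap \<sigma> j = enat K"
    using fin by (cases "max_gap \<sigma> j") auto
  have gap: "?l (Suc k) - ?l k \<le> K" for k
  proof -
    have "enat (?l (Suc k) - ?l (Suc k - 1)) \<le> max_gap \<sigma> j"
      unfolding max_gap_def by (rule SUP_upper) simp
    then show ?thesis
      by (simp add: K)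
  qed
  have "\<exists>k\<le>K. n + k \<in> fiber \<sigma> j" for n
  proof -
    \<comment> \<open>As \<open>enumerate\<close> counts from \<open>0\<close>,
      \<open>?l (Suc k)\<close> is the first element of the fiber not below \<open>n\<close>, and
      \<open>?l k\<close> is the one before it, or \<open>0\<close> when \<open>k = 0\<close>. So
      \<open>n\<close> lies between two consecutive terms, and the wait is at most their
      gap.\<close>
    define k where "k = (LEAST k. n \<le> enumerate (fiber \<sigma> j) k)"
    have "\<exists>k. n \<le> enumerate (fiber \<sigma> j) k"
      using le_enumerate[OF inf] by blast
    then have ge: "n \<le> ?l (Suc k)"
      unfolding k_def fiber_enum_def by (auto intro: LeastI_ex)
    have "?l k \<le> n"
    proof (cases k)
      case (Suc i)
      then have "\<not> n \<le> enumerate (fiber \<sigma> j) i"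
        unfolding k_def by (intro not_less_Least) simp
      then show ?thesis
        by (simp add: Suc fiber_enum_def)
    qed (simp add: fiber_enum_def)
    then have "?l (Suc k) - n \<le> K"
      using gap[of k] by linarith
    moreover have "?l (Suc k) \<in> fiber \<sigma> j"
      using enumerate_in_set[OF inf] by (simp add: fiber_enum_def)
    ultimately show ?thesis
      using ge by (intro exI[of _ "?l (Suc k) - n"]) simp
  qed
  then show thesis
    by (rule that)
qed

theorem theorem2p7:
  fixes M :: "nat \<Rightarrow> 'a::chilbert_space set"
    and P T :: "nat \<Rightarrow> 'a \<Rightarrow> 'a"
    and \<sigma> :: "nat \<Rightarrow> nat"
  assumes "\<And>n. n \<ge> 1 \<Longrightarrow> csubspace (M n) \<and> closed (M n)"
    and "\<And>n. n \<ge> 1 \<Longrightarrow> bounded_clinear (P n) \<and> P n = orth_proj (M n)"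
    and "infinite_periodic \<sigma>"
    and "Gamma_inf \<sigma> = {}"
    and "T 1 = P (\<sigma> 1)"
    and "\<And>n. n \<ge> 2 \<Longrightarrow> T n = P (\<sigma> n) \<circ> T (n - 1)"
  shows "\<forall>x. weakly_converges (\<lambda>n. T n x) (orth_proj (\<Inter>i\<in>{1..}. range (P i)) x)"
proof
  fix x
  \<comment> \<open>Putting \<open>x\<close> at index \<open>0\<close> turns \<open>T 1\<close> into
    an ordinary projection step and makes \<open>x\<close> the starting point of the orbit.\<close>
  define u where "u n = (if n = 0 then x else T n x)" for n
  have \<sigma>: "\<sigma> n \<ge> 1" if "n \<ge> 1" for n
    using assms(3) that by (force simp: infinite_periodic_def)
  have P: "P n = orth_proj (M n)" and M: "csubspace (M n)" "closed (M n)" if "n \<ge> 1" for n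
    using assms(1,2)[OF that] by auto
  have step: "u (Suc n) = orth_proj (M (\<sigma> (Suc n))) (u n)" for n
    using assms(5) assms(6)[of "Suc n"] P[OF \<sigma>, of "Suc n"] by (cases n) (auto simp: u_def)
  have visit: "\<exists>K. \<forall>n. \<exists>k\<le>K. u (n + k) \<in> M j" if j: "j \<in> {1..}" for j
  proof -
    have "infinite (fiber \<sigma> j)" "max_gap \<sigma> j < \<infinity>"
      using assms(3,4) j by (auto simp: infinite_periodic_def Gamma_inf_def Gamma_F_def)
    then obtain K where K: "\<And>n. \<exists>k\<le>K. n + k \<in> fiber \<sigma> j"
      using bounded_gap_visit by blast
    have "u m \<in> M j" if m: "m \<in> fiber \<sigma> j" for m
    proof -
      \<comment> \<open>Elements of a fiber are positive, so \<open>u m\<close> is the result of a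
        projection, namely the one onto \<open>M j\<close>.\<close>
      obtain i where "m = Suc i" "\<sigma> m = j"
        using m by (cases m) (auto simp: fiber_def)
      then show ?thesis
        using orth_proj_in[OF M, of j] j step[of i] by simp
    qed
    with K show ?thesis
      by blast
  qed
  have "weakly_converges u (orth_proj (\<Inter>i\<in>{1..}. M i) (u 0))"
    \<comment> \<open>The shift by \<open>Suc\<close> arises because the step from
      \<open>u n\<close> to \<open>u (Suc n)\<close> projects onto the subspace with index
      \<open>\<sigma> (Suc n)\<close>.\<close>
    by (rule orbit_weakly_converges[of "\<lambda>n. M (\<sigma> (Suc n))"])
      (use step visit M \<sigma> in auto)
  moreover have "(\<Inter>i\<in>{1..}. range (P i)) = (\<Inter>i\<in>{1..}. M i)"
    by (rule INF_cong) (simp_all add: P M range_orth_proj)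
  \<comment> \<open>The two sequences agree from index \<open>1\<close> on, so the value of
    \<open>T 0\<close> does not affect the limit.\<close>
  moreover have "(\<lambda>n. cinner (T n x) y) \<longlonglongrightarrow> l \<longleftrightarrow> (\<lambda>n. cinner (u n) y) \<longlonglongrightarrow> l" for y l
    by (rule tendsto_cong) (auto simp: u_def eventually_sequentially intro!: exI[of _ 1])
  ultimately show "weakly_converges (\<lambda>n. T n x) (orth_proj (\<Inter>i\<in>{1..}. range (P i)) x)"
    by (simp add: weakly_converges_def u_def)
qed

end
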